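(* Let $S=(\mathcal G,E)$ be a semilattice of groups, and let $\mathrm{Sha}(\mathcal G,E)$ denote the set of all elements of $\mathrm{Hol}(\mathcal G,E)$ whose action on $S$ preserves the heap operation $\langle a,b,c\rangle=ab^{-1}c$, i.e. those $(\lambda,\phi,\tau)\in\mathrm{Hol}(\mathcal G,E)$ such that $\langle a,b,c\rangle\lhd(\lambda,\phi,\tau)=\langle a\lhd(\lambda,\phi,\tau),\,b\lhd(\lambda,\phi,\tau),\,c\lhd(\lambda,\phi,\tau)\rangle$ for all $a,b,c\in S$. Then $$\mathrm{Sha}(\mathcal G,E)=\{(\lambda,\phi,\tau):(\lambda,\phi)\in\mathrm{End}(\mathcal G,E),\ \tau:E\to S\text{ order-preserving},\ e\tau\in G_{e\lambda}\text{ for all }e\in E\}.$$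
   Context: Functions are written on the right and composed left to right. Let $E$ be a (meet) semilattice, written multiplicatively. A semilattice of groups $S=(\mathcal G,E)$ is given by groups $G_e$ ($e\in E$) and homomorphisms $\alpha^e_f:G_e\to G_f$ for $e\ge f$ in $E$, with $\alpha^e_e=\mathrm{id}$ and $\alpha^k_f\alpha^f_e=\alpha^k_e$ for $k\ge f\ge e$. $S$ is the disjoint union of the $G_e$, with the product of $g\in G_x$ and $h\in G_y$ being $(g\alpha^x_{xy})(h\alpha^y_{xy})\in G_{xy}$; it is an inverse semigroup. Its natural partial order is: for $g\in G_e$ and $h\in G_f$, $g\ge h$ iff $e\ge f$ and $h=g\alpha^e_f$. A premorphism of $S$ (a function $\theta:S\to S$ with $(ab)\theta\le(a\theta)(b\theta)$ for all $a,b$) is specified by a pair $(\lambda,\phi)$, where $\lambda:E\to E$ is order-preserving and $\phi=(\phi_e)_{e\in E}$ is a family of group homomorphisms $\phi_e:G_e\to G_{e\lambda}$ with $\phi_e\alpha^{e\lambda}_{f\lambda}=\alpha^e_f\phi_f$ whenever $e\ge f$; the premorphism maps $g\in G_e$ to $g\phi_e$. The set of such pairs is $\mathrm{Prem}(\mathcal G,E)$. Endomorphisms of $S$ correspond to the pairs $(\lambda,\phi)$ in which $\lambda$ is meet-preserving; the set of these is $\mathrm{End}(\mathcal G,E)$. The holomorph is $$\mathrm{Hol}(\mathcal G,E)=\{(\lambda,\phi,\tau):(\lambda,\phi)\in\mathrm{Prem}(\mathcal G,E),\ \tau:E\to S\text{ order-preserving},\ e\tau\in G_{e\lambda}\ \forall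 e\in E\},$$ and it acts on $S$ by $a\lhd(\lambda,\phi,\tau)=(a\phi_x)(x\tau)$ for $a\in G_x$. (The set $\mathrm{Sha}(\mathcal G,E)$ is identified with the monoid of order-preserving, heap-preserving functions on $S$ via this action.) *)

theory Defs
  imports "HOL-Algebra.Group"
begin

locale semilattice_of_groups =
  fixes G :: "'e::semilattice_inf \<Rightarrow> ('g, 'm) monoid_scheme"
    and \<alpha> :: "'e \<Rightarrow> 'e \<Rightarrow> 'g \<Rightarrow> 'g"
  assumes group_G: "group (G e)"
    and hom_\<alpha>: "f \<le> e \<Longrightarrow> \<alpha> e f \<in> hom (G e) (G f)"
    and \<alpha>_id: "g \<in> carrier (G e) \<Longrightarrow> \<alpha> e e g = g"
    and \<alpha>_comp: "e \<le> f \<Longrightarrow> f \<le> k \<Longrightarrow> g \<in> carrier (G k) \<Longrightarrow> \<alpha> f e (\<alpha> k f g) = \<alpha> k e g"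

text \<open>The disjoint union is realised by tagging: an element \<open>g\<close> of the group at \<open>e\<close> is the
  pair \<open>(e, g)\<close>, so the carriers \<open>carrier (G e)\<close> themselves may overlap.\<close>

definition component :: "('e \<Rightarrow> ('g, 'm) monoid_scheme) \<Rightarrow> 'e \<Rightarrow> ('e \<times> 'g) set" where
  "component G e = {e} \<times> carrier (G e)"

definition elems :: "('e \<Rightarrow> ('g, 'm) monoid_scheme) \<Rightarrow> ('e \<times> 'g) set" where
  "elems G = (\<Union>e. component G e)"

definition sg_mult ::
  "('e::semilattice_inf \<Rightarrow> ('g, 'm) monoid_scheme) \<Rightarrow> ('e \<Rightarrow> 'e \<Rightarrow> 'g \<Rightarrow> 'g) \<Rightarrow>
    'e \<times> 'g \<Rightarrow> 'e \<times> 'g \<Rightarrow> 'e \<times> 'g" where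
  "sg_mult G \<alpha> = (\<lambda>(x, g) (y, h).
     (inf x y, \<alpha> x (inf x y) g \<otimes>\<^bsub>G (inf x y)\<^esub> \<alpha> y (inf x y) h))"

definition sg_le :: "('e::semilattice_inf \<Rightarrow> 'e \<Rightarrow> 'g \<Rightarrow> 'g) \<Rightarrow> 'e \<times> 'g \<Rightarrow> 'e \<times> 'g \<Rightarrow> bool" where
  "sg_le \<alpha> = (\<lambda>(f, h) (e, g). f \<le> e \<and> h = \<alpha> e f g)"

text \<open>The inverse in the sense of inverse semigroups; \<open>sg_inv_eq\<close> below shows that it exists,
  is unique, and is the group inverse in the component.\<close>

definition sg_inv ::
  "('e::semilattice_inf \<Rightarrow> ('g, 'm) monoid_scheme) \<Rightarrow> ('e \<Rightarrow> 'e \<Rightarrow> 'g \<Rightarrow> 'g) \<Rightarrow>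
    'e \<times> 'g \<Rightarrow> 'e \<times> 'g" where
  "sg_inv G \<alpha> a = (THE b. b \<in> elems G \<and>
     sg_mult G \<alpha> (sg_mult G \<alpha> a b) a = a \<and> sg_mult G \<alpha> (sg_mult G \<alpha> b a) b = b)"

definition heap ::
  "('e::semilattice_inf \<Rightarrow> ('g, 'm) monoid_scheme) \<Rightarrow> ('e \<Rightarrow> 'e \<Rightarrow> 'g \<Rightarrow> 'g) \<Rightarrow>
    'e \<times> 'g \<Rightarrow> 'e \<times> 'g \<Rightarrow> 'e \<times> 'g \<Rightarrow> 'e \<times> 'g" where
  "heap G \<alpha> a b c = sg_mult G \<alpha> (sg_mult G \<alpha> a (sg_inv G \<alpha> b)) c"

text \<open>Each \<open>\<phi> e\<close> is required to be extensional, so that a family of maps between carriers is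
  represented by exactly one function.\<close>

definition Prem ::
  "('e::semilattice_inf \<Rightarrow> ('g, 'm) monoid_scheme) \<Rightarrow> ('e \<Rightarrow> 'e \<Rightarrow> 'g \<Rightarrow> 'g) \<Rightarrow>
    (('e \<Rightarrow> 'e) \<times> ('e \<Rightarrow> 'g \<Rightarrow> 'g)) set" where
  "Prem G \<alpha> = {(l, \<phi>). mono l \<and>
     (\<forall>e. \<phi> e \<in> hom (G e) (G (l e)) \<inter> extensional (carrier (G e))) \<and>
     (\<forall>e f. f \<le> e \<longrightarrow> (\<forall>g\<in>carrier (G e). \<alpha> (l e) (l f) (\<phi> e g) = \<phi> f (\<alpha> e f g)))}"

definition End ::
  "('e::semilattice_inf \<Rightarrow> ('g, 'm) monoid_scheme) \<Rightarrow> ('e \<Rightarrow> 'e \<Rightarrow> 'g \<Rightarrow> 'g) \<Rightarrow>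
    (('e \<Rightarrow> 'e) \<times> ('e \<Rightarrow> 'g \<Rightarrow> 'g)) set" where
  "End G \<alpha> = {(l, \<phi>) \<in> Prem G \<alpha>. \<forall>x y. l (inf x y) = inf (l x) (l y)}"

definition Hol ::
  "('e::semilattice_inf \<Rightarrow> ('g, 'm) monoid_scheme) \<Rightarrow> ('e \<Rightarrow> 'e \<Rightarrow> 'g \<Rightarrow> 'g) \<Rightarrow>
    (('e \<Rightarrow> 'e) \<times> ('e \<Rightarrow> 'g \<Rightarrow> 'g) \<times> ('e \<Rightarrow> 'e \<times> 'g)) set" where
  "Hol G \<alpha> = {(l, \<phi>, \<tau>). (l, \<phi>) \<in> Prem G \<alpha> \<and>
     monotone (\<le>) (sg_le \<alpha>) \<tau> \<and> (\<forall>e. \<tau> e \<in> component G (l e))}"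

definition act ::
  "('e::semilattice_inf \<Rightarrow> ('g, 'm) monoid_scheme) \<Rightarrow> ('e \<Rightarrow> 'e \<Rightarrow> 'g \<Rightarrow> 'g) \<Rightarrow>
    'e \<times> 'g \<Rightarrow> ('e \<Rightarrow> 'e) \<times> ('e \<Rightarrow> 'g \<Rightarrow> 'g) \<times> ('e \<Rightarrow> 'e \<times> 'g) \<Rightarrow> 'e \<times> 'g" where
  "act G \<alpha> = (\<lambda>(x, g) (l, \<phi>, \<tau>). sg_mult G \<alpha> (l x, \<phi> x g) (\<tau> x))"

definition Sha ::
  "('e::semilattice_inf \<Rightarrow> ('g, 'm) monoid_scheme) \<Rightarrow> ('e \<Rightarrow> 'e \<Rightarrow> 'g \<Rightarrow> 'g) \<Rightarrow>
    (('e \<Rightarrow> 'e) \<times> ('e \<Rightarrow> 'g \<Rightarrow> 'g) \<times> ('e \<Rightarrow> 'e \<times> 'g)) set" where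
  "Sha G \<alpha> = {t \<in> Hol G \<alpha>. \<forall>a\<in>elems G. \<forall>b\<in>elems G. \<forall>c\<in>elems G.
     act G \<alpha> (heap G \<alpha> a b c) t = heap G \<alpha> (act G \<alpha> a t) (act G \<alpha> b t) (act G \<alpha> c t)}"

context semilattice_of_groups
begin

lemma sg_inv_eq:
  assumes g: "g \<in> carrier (G x)"
  shows "sg_inv G \<alpha> (x, g) = (x, inv\<^bsub>G x\<^esub> g)"
  unfolding sg_inv_def
proof (rule the_equality)
  interpret Gx: group "G x" by (rule group_G)
  show "(x, inv\<^bsub>G x\<^esub> g) \<in> elems G \<and>
      sg_mult G \<alpha> (sg_mult G \<alpha> (x, g) (x, inv\<^bsub>G x\<^esub> g)) (x, g) = (x, g) \<and>
      sg_mult G \<alpha> (sg_mult G \<alpha> (x, inv\<^bsub>G x\<^esub> g) (x, g)) (x, inv\<^bsub>G x\<^esub> g) = (x, inv\<^bsub>G x\<^esub> g)"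
    using g by (simp add: elems_def component_def sg_mult_def \<alpha>_id)
  fix b
  assume b: "b \<in> elems G \<and> sg_mult G \<alpha> (sg_mult G \<alpha> (x, g) b) (x, g) = (x, g) \<and>
      sg_mult G \<alpha> (sg_mult G \<alpha> b (x, g)) b = b"
  obtain y h where bh: "b = (y, h)" by (cases b)
  have "inf (inf x y) x = x" "inf (inf y x) y = y"
    using b by (simp_all add: bh sg_mult_def)
  hence "y = x" by (metis inf.commute inf_left_idem)
  hence h: "h \<in> carrier (G x)" and "g \<otimes>\<^bsub>G x\<^esub> h \<otimes>\<^bsub>G x\<^esub> g = g"
    using b g by (auto simp: bh elems_def component_def sg_mult_def \<alpha>_id)
  hence "g \<otimes>\<^bsub>G x\<^esub> h = \<one>\<^bsub>G x\<^esub>"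
    using g Gx.r_cancel_one by simp
  hence "h = inv\<^bsub>G x\<^esub> g"
    using g h by (metis Gx.inv_equality Gx.inv_inv Gx.inv_closed)
  thus "b = (x, inv\<^bsub>G x\<^esub> g)" using bh \<open>y = x\<close> by simp
qed

end

end

theory Submission
  imports Defs
begin

text \<open>Write \<open>\<tau> e = (l e, t e)\<close>. Comparing the components of \<open>\<langle>a, b, b\<rangle> \<lhd> (l, \<phi>, \<tau>)\<close> shows that \<open>l\<close>
  preserves meets. Conversely, if \<open>l\<close> preserves meets, both sides of the heap identity for
  elements over \<open>x\<close>, \<open>y\<close>, \<open>z\<close> lie over \<open>l m\<close> with \<open>m = x \<sqinter> y \<sqinter> z\<close>. Since \<open>\<tau>\<close> is
  order-preserving, \<open>t x\<close>, \<open>t y\<close>, \<open>t z\<close> all restrict to \<open>t m\<close>, and a group homomorphism followed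
  by right translation by \<open>t m\<close> preserves the heap of a group.\<close>

context semilattice_of_groups
begin

lemma \<alpha>_closed: "f \<le> e \<Longrightarrow> g \<in> carrier (G e) \<Longrightarrow> \<alpha> e f g \<in> carrier (G f)"
  using hom_\<alpha> by (auto simp: hom_def)

lemma \<alpha>_mult:
  "f \<le> e \<Longrightarrow> g \<in> carrier (G e) \<Longrightarrow> h \<in> carrier (G e) \<Longrightarrow>
    \<alpha> e f (g \<otimes>\<^bsub>G e\<^esub> h) = \<alpha> e f g \<otimes>\<^bsub>G f\<^esub> \<alpha> e f h"
  using hom_\<alpha> by (auto simp: hom_def)

lemma \<alpha>_inv:
  assumes "f \<le> e" "g \<in> carrier (G e)"
  shows "\<alpha> e f (inv\<^bsub>G e\<^esub> g) = inv\<^bsub>G f\<^esub> (\<alpha> e f g)"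
proof -
  interpret group_hom "G e" "G f" "\<alpha> e f"
    using assms by (intro group_hom.intro group_G group_hom_axioms.intro hom_\<alpha>)
  show ?thesis using assms by simp
qed

text \<open>Inverses are taken in the components and commute with the maps \<open>\<alpha>\<close>,
  and restrictions compose. So all three factors can be restricted directly to \<open>m\<close>, and
  the heap of \<open>S\<close> becomes the heap of the single group \<open>G m\<close>.\<close>

lemma heap_eq:
  fixes x y z
  defines "m \<equiv> inf (inf x y) z"
  assumes a: "a \<in> carrier (G x)" and b: "b \<in> carrier (G y)" and c: "c \<in> carrier (G z)"
  shows "heap G \<alpha> (x, a) (y, b) (z, c) =
    (m, \<alpha> x m a \<otimes>\<^bsub>G m\<^esub> inv\<^bsub>G m\<^esub> (\<alpha> y m b) \<otimes>\<^bsub>G m\<^esub> \<alpha> z m c)"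
proof -
  interpret Gy: group "G y" by (rule group_G)
  interpret Gxy: group "G (inf x y)" by (rule group_G)
  have m: "m \<le> inf x y" "m \<le> y" by (simp_all add: m_def le_infI1)
  show ?thesis
    using a b c m
    by (simp add: heap_def sg_inv_eq sg_mult_def \<alpha>_mult \<alpha>_closed \<alpha>_comp \<alpha>_inv
        flip: m_def)
qed

lemma act_eq:
  assumes "\<phi> x \<in> hom (G x) (G (l x))" "\<tau> x = (l x, t)" "t \<in> carrier (G (l x))"
    and "g \<in> carrier (G x)"
  shows "act G \<alpha> (x, g) (l, \<phi>, \<tau>) = (l x, \<phi> x g \<otimes>\<^bsub>G (l x)\<^esub> t)"
  using assms by (simp add: act_def sg_mult_def \<alpha>_id hom_in_carrier)

end

text \<open>Since \<open>inv (q \<otimes> t) = inv t \<otimes> inv q\<close>, the first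
  \<open>t\<close> cancels against \<open>inv t\<close>, and only the last \<open>t\<close>
  survives.\<close>

lemma (in group) mult_inv_mult_translate:
  assumes "p \<in> carrier G" "q \<in> carrier G" "r \<in> carrier G" "t \<in> carrier G"
  shows "(p \<otimes> t) \<otimes> inv (q \<otimes> t) \<otimes> (r \<otimes> t) = p \<otimes> inv q \<otimes> r \<otimes> t"
proof -
  have "t \<otimes> (inv t \<otimes> x) = x" if "x \<in> carrier G" for x
    using assms that by (simp flip: m_assoc)
  then show ?thesis using assms by (simp add: inv_mult_group m_assoc)
qed

text \<open>The left side cuts \<open>Sha\<close> out of \<open>Hol\<close>, the right side cuts
  \<open>End\<close> out of \<open>Prem\<close>; the theorem is this equivalence read for every
  triple.\<close>

lemma (in semilattice_of_groups) Hol_heap_preserving_iff: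
  assumes Hol: "(l, \<phi>, \<tau>) \<in> Hol G \<alpha>"
  shows "(\<forall>a\<in>elems G. \<forall>b\<in>elems G. \<forall>c\<in>elems G. act G \<alpha> (heap G \<alpha> a b c) (l, \<phi>, \<tau>) =
      heap G \<alpha> (act G \<alpha> a (l, \<phi>, \<tau>)) (act G \<alpha> b (l, \<phi>, \<tau>)) (act G \<alpha> c (l, \<phi>, \<tau>)))
    \<longleftrightarrow> (\<forall>x y. l (inf x y) = inf (l x) (l y))"
    (is "?heap \<longleftrightarrow> ?meet")
proof -
  define t where "t x = snd (\<tau> x)" for x
  have mono_l: "mono l" and \<phi>: "\<And>e. \<phi> e \<in> hom (G e) (G (l e))"
    and \<phi>_nat: "\<And>e f g. f \<le> e \<Longrightarrow> g \<in> carrier (G e) \<Longrightarrow>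
        \<alpha> (l e) (l f) (\<phi> e g) = \<phi> f (\<alpha> e f g)"
    and mono_\<tau>: "monotone (\<le>) (sg_le \<alpha>) \<tau>"
    and \<tau>_comp: "\<And>e. \<tau> e \<in> component G (l e)"
    using Hol by (auto simp: Hol_def Prem_def)
  have \<tau>: "\<tau> e = (l e, t e)" "t e \<in> carrier (G (l e))" for e
    using \<tau>_comp[of e] by (auto simp: component_def t_def)
  have t_restrict: "\<alpha> (l e) (l f) (t e) = t f" if "f \<le> e" for e f
    using monotoneD[OF mono_\<tau> that] by (simp add: \<tau>(1) sg_le_def)
  note act = act_eq[of \<phi> _ l \<tau>, OF \<phi> \<tau>]
  note \<phi>_closed = hom_in_carrier[OF \<phi>]
  have act_closed: "\<phi> x g \<otimes>\<^bsub>G (l x)\<^esub> t x \<in> carrier (G (l x))"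
    if "g \<in> carrier (G x)" for x g
  proof -
    interpret group "G (l x)" by (rule group_G)
    show ?thesis using that by (simp add: \<phi>_closed \<tau>)
  qed
  show ?thesis
  proof
    assume ?heap
    show ?meet
    proof (intro allI)
      fix x y
      interpret X: group "G x" by (rule group_G)
      interpret Y: group "G y" by (rule group_G)
      \<comment> \<open>Only first coordinates matter below, so any elements over \<open>x\<close>
        and \<open>y\<close> would do. Repeating \<open>?b\<close> in the heap keeps the base point
        at the meet of \<open>x\<close> and \<open>y\<close>.\<close>
      let ?a = "(x, \<one>\<^bsub>G x\<^esub>)" and ?b = "(y, \<one>\<^bsub>G y\<^esub>)"
      have ab: "?a \<in> elems G" "?b \<in> elems G"
        by (auto simp: elems_def component_def)
      have "act G \<alpha> (heap G \<alpha> ?a ?b ?b) (l, \<phi>, \<tau>) =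
          heap G \<alpha> (act G \<alpha> ?a (l, \<phi>, \<tau>)) (act G \<alpha> ?b (l, \<phi>, \<tau>)) (act G \<alpha> ?b (l, \<phi>, \<tau>))"
        using \<open>?heap\<close> ab by blast
      then have "l (inf (inf x y) y) = inf (inf (l x) (l y)) (l y)"
        by (simp add: heap_eq act act_closed)
          (simp add: act_def sg_mult_def \<tau>(1))
      then show "l (inf x y) = inf (l x) (l y)" by (simp add: inf.assoc)
    qed
  next
    assume meet: ?meet
    show ?heap
    proof (intro ballI)
      fix a' b' c' assume "a' \<in> elems G" "b' \<in> elems G" "c' \<in> elems G"
      then obtain x a y b z c where eqs: "a' = (x, a)" "b' = (y, b)" "c' = (z, c)"
        and a: "a \<in> carrier (G x)" and b: "b \<in> carrier (G y)" and c: "c \<in> carrier (G z)"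
        by (auto simp: elems_def component_def)
      define m where "m = inf (inf x y) z"
      have m: "m \<le> x" "m \<le> y" "m \<le> z" by (simp_all add: m_def le_infI1)
      \<comment> \<open>Meet preservation enters here: it puts the heap of the images over
        \<open>l m\<close>, where the image of the heap lies.\<close>
      have lm: "inf (inf (l x) (l y)) (l z) = l m" by (simp add: m_def meet)
      interpret Gm: group "G m" by (rule group_G)
      interpret Glm: group "G (l m)" by (rule group_G)
      interpret \<phi>: group_hom "G m" "G (l m)" "\<phi> m" by unfold_locales (rule \<phi>)
      \<comment> \<open>Naturality of \<open>\<phi>\<close> and monotonicity of
        \<open>\<tau>\<close> turn the restricted image into the image of the restriction. All three
        factors thus acquire the same right translation \<open>t m\<close>.\<close>
      have restrict: "\<alpha> (l e) (l m) (\<phi> e g \<otimes>\<^bsub>G (l e)\<^esub> t e) = \<phi> m (\<alpha> e m g) \<otimes>\<^bsub>G (l m)\<^esub> t m"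
        if "m \<le> e" "g \<in> carrier (G e)" for e g
        using that monoD[OF mono_l that(1)]
        by (simp add: \<alpha>_mult \<phi>_closed \<tau> \<phi>_nat t_restrict)
      have "heap G \<alpha> (act G \<alpha> a' (l, \<phi>, \<tau>)) (act G \<alpha> b' (l, \<phi>, \<tau>)) (act G \<alpha> c' (l, \<phi>, \<tau>)) =
        (l m, (\<phi> m (\<alpha> x m a) \<otimes>\<^bsub>G (l m)\<^esub> t m) \<otimes>\<^bsub>G (l m)\<^esub>
          inv\<^bsub>G (l m)\<^esub> (\<phi> m (\<alpha> y m b) \<otimes>\<^bsub>G (l m)\<^esub> t m) \<otimes>\<^bsub>G (l m)\<^esub>
          (\<phi> m (\<alpha> z m c) \<otimes>\<^bsub>G (l m)\<^esub> t m))"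
        using a b c m by (simp add: eqs act heap_eq act_closed lm restrict)
      \<comment> \<open>The common translation is pulled out, and the homomorphism
        \<open>\<phi> m\<close> collects the remaining heap.\<close>
      also have "\<dots> = (l m, \<phi> m (\<alpha> x m a \<otimes>\<^bsub>G m\<^esub> inv\<^bsub>G m\<^esub> (\<alpha> y m b) \<otimes>\<^bsub>G m\<^esub> \<alpha> z m c)
          \<otimes>\<^bsub>G (l m)\<^esub> t m)"
        using a b c m by (simp add: Glm.mult_inv_mult_translate \<alpha>_closed \<tau>)
      also have "\<dots> = act G \<alpha> (heap G \<alpha> a' b' c') (l, \<phi>, \<tau>)"
        using a b c m by (simp add: eqs heap_eq act \<alpha>_closed flip: m_def)
      finally show "act G \<alpha> (heap G \<alpha> a' b' c') (l, \<phi>, \<tau>) =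
        heap G \<alpha> (act G \<alpha> a' (l, \<phi>, \<tau>)) (act G \<alpha> b' (l, \<phi>, \<tau>)) (act G \<alpha> c' (l, \<phi>, \<tau>))" ..
    qed
  qed
qed

theorem mainTheorem4:
  fixes G :: "'e::semilattice_inf \<Rightarrow> ('g, 'm) monoid_scheme"
    and \<alpha> :: "'e \<Rightarrow> 'e \<Rightarrow> 'g \<Rightarrow> 'g"
  assumes "semilattice_of_groups G \<alpha>"
  shows "Sha G \<alpha> = {(l, \<phi>, \<tau>). (l, \<phi>) \<in> End G \<alpha> \<and>
    monotone (\<le>) (sg_le \<alpha>) \<tau> \<and> (\<forall>e. \<tau> e \<in> component G (l e))}"
proof -
  have "(l, \<phi>, \<tau>) \<in> Sha G \<alpha> \<longleftrightarrow> (l, \<phi>, \<tau>) \<in> Hol G \<alpha> \<and> (\<forall>x y. l (inf x y) = inf (l x) (l y))"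
    for l \<phi> \<tau>
    unfolding Sha_def
    using semilattice_of_groups.Hol_heap_preserving_iff[OF assms, of l \<phi> \<tau>] by blast
  then show ?thesis by (auto simp: Hol_def End_def)
qed

end
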